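(* There exists a constant $c_0 > 0$ such that $\mathsf{m}(A) \ge c_0 A^2$ for all real $A > 0$; i.e., $\mathsf{m}(A) = \Omega(A^2)$.
   Context: Let $\varphi(t) = \frac{1}{\sqrt{2\pi}} e^{-\frac12 t^2}$ for $t \in \mathbb{R}$ be the standard Gaussian density. A mixture of Gaussian densities with variance $1$ and means in $[-A,A]$ is a convex combination $f(t) = \sum_{k=1}^N p_k \varphi(t-a_k)$, where $N \ge 1$ is an integer (not fixed in advance), $a_k \in [-A,A]$ for all $k$, $p_k > 0$ for all $k$, and $\sum_{k=1}^N p_k = 1$. A mode of such a density $f$ is a local maximum of $f$ on $\mathbb{R}$. For $A > 0$, $\mathsf{m}(A)$ denotes the maximum number of modes that any mixture of Gaussian densities with variance $1$ and means in $[-A,A]$ can have (the maximum being over all integers $N \ge 1$, all $p_1,\ldots,p_N > 0$ with $\sum_{k=1}^N p_k = 1$, and all $a_1,\ldots,a_N \in [-A,A]$). The notation $g(A) = \Omega(f(A))$ means that there exists a constant $\kappa_0 > 0$ such that $g(A) \ge \kappa_0 f(A)$ for all $A > 0$. *)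

theory Defs
  imports "HOL-Probability.Probability"
begin

text \<open>The standard Gaussian density is the library's \<^const>\<open>normal_density\<close> with mean
  \<open>0\<close> and standard deviation \<open>1\<close>, abbreviated \<open>std_normal_density\<close>;
  see \<open>std_normal_density_def\<close>.\<close>

definition gaussian_mixture :: "real \<Rightarrow> (real \<Rightarrow> real) \<Rightarrow> bool" where
  "gaussian_mixture A f \<longleftrightarrow>
     (\<exists>(N::nat) (p :: nat \<Rightarrow> real) (a :: nat \<Rightarrow> real).
        N \<ge> 1 \<and>
        (\<forall>k\<in>{1..N}. p k > 0) \<and> (\<Sum>k=1..N. p k) = 1 \<and>
        (\<forall>k\<in>{1..N}. a k \<in> {-A..A}) \<and>
        f = (\<lambda>t. \<Sum>k=1..N. p k * std_normal_density (t - a k)))"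

definition modes :: "(real \<Rightarrow> real) \<Rightarrow> real set" where
  "modes f = {t. \<forall>\<^sub>F s in nhds t. f s \<le> f t}"

definition num_modes :: "(real \<Rightarrow> real) \<Rightarrow> enat" where
  "num_modes f = (if finite (modes f) then enat (card (modes f)) else \<infinity>)"

text \<open>The maximum number of modes is taken as a supremum in \<^typ>\<open>enat\<close>, so that the
  definition does not presuppose a bound on the number of modes that is uniform in \<open>N\<close>.
  A finite supremum of a nonempty set of extended naturals is attained, so this is the
  maximum whenever the maximum is a natural number.\<close>

definition max_modes :: "real \<Rightarrow> enat" where
  "max_modes A = (SUP f \<in> {f. gaussian_mixture A f}. num_modes f)"

end

theory Submission
  imports Defs
begin

text \<open>
  Mixing with the weight \<open>1 - cos (\<omega> x)\<close> over the whole line yields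
  \<open>1 - exp (- \<omega>\<^sup>2 / 2) cos (\<omega> t)\<close>, whose ripples are tiny but present on all of the line.
  Restricting the means to \<open>[-A, A]\<close> changes this on \<open>[-A/2, A/2]\<close> only by a Gaussian tail of
  order \<open>exp (- A\<^sup>2 / 16)\<close>, so for \<open>\<omega> = A / 4\<close> the ripples of amplitude \<open>exp (- A\<^sup>2 / 32)\<close>
  survive, and there are of the order of \<open>\<omega> A\<close> of them. Being a strict up-and-down pattern of values
  at finitely many points, they also survive a sufficiently fine Riemann sum, which is a finite mixture.
\<close>

section \<open>Counting modes through an up-and-down pattern of values\<close>

text \<open>The maximum over the compact interval cannot sit at an endpoint, because
  \<open>c\<close> beats both; an interior maximum is a local maximum on the whole line.\<close>

lemma mode_between:
  fixes f :: "real \<Rightarrow> real"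
  assumes "continuous_on {a..b} f" "a < c" "c < b" "f a < f c" "f b < f c"
  obtains t where "t \<in> modes f" "a < t" "t < b"
proof -
  have "\<exists>t\<in>{a..b}. \<forall>s\<in>{a..b}. f s \<le> f t"
    by (rule continuous_attains_sup) (use assms in auto)
  then obtain t where t: "t \<in> {a..b}" and max: "\<And>s. s \<in> {a..b} \<Longrightarrow> f s \<le> f t"
    by blast
  have "f c \<le> f t" using max[of c] assms by auto
  then have "t \<noteq> a" "t \<noteq> b" using assms by auto
  with t have lt: "a < t" "t < b" by auto
  have "\<forall>\<^sub>F s in nhds t. s \<in> {a<..<b}"
    by (rule eventually_nhds_in_open) (use lt in auto)
  then have "\<forall>\<^sub>F s in nhds t. f s \<le> f t"
    by eventually_elim (use max in auto)
  then show thesis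
    using that lt by (auto simp: modes_def)
qed

text \<open>Each triple \<open>u (2 * j)\<close>, \<open>u (2 * j + 1)\<close>,
  \<open>u (2 * j + 2)\<close> encloses a mode strictly between its outer points. These open
  intervals are pairwise disjoint, so the modes are distinct.\<close>

lemma num_modes_ge:
  fixes f :: "real \<Rightarrow> real" and u :: "nat \<Rightarrow> real"
  assumes cont: "continuous_on UNIV f" and u: "strict_mono u"
    and up: "\<And>j. j < n \<Longrightarrow> f (u (2 * j)) < f (u (2 * j + 1))"
    and down: "\<And>j. j < n \<Longrightarrow> f (u (2 * j + 2)) < f (u (2 * j + 1))"
  shows "enat n \<le> num_modes f"
proof -
  have "\<exists>t. t \<in> modes f \<and> u (2 * j) < t \<and> t < u (2 * j + 2)" if "j < n" for j
  proof (rule mode_between[of "u (2 * j)" "u (2 * j + 2)" f "u (2 * j + 1)"])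
    show "continuous_on {u (2 * j)..u (2 * j + 2)} f"
      using cont continuous_on_subset by blast
    show "u (2 * j) < u (2 * j + 1)" "u (2 * j + 1) < u (2 * j + 2)"
      by (rule strict_monoD[OF u], simp)+
  qed (use up down that in auto)
  then obtain m where m: "\<And>j. j < n \<Longrightarrow> m j \<in> modes f"
    and lo: "\<And>j. j < n \<Longrightarrow> u (2 * j) < m j" and hi: "\<And>j. j < n \<Longrightarrow> m j < u (2 * j + 2)"
    by metis
  have less: "m i < m j" if "i < j" "j < n" for i j
  proof -
    have "u (2 * i + 2) \<le> u (2 * j)"
      using that by (intro monoD[OF strict_mono_mono[OF u]]) auto
    then show ?thesis using hi[of i] lo[of j] that by linarith
  qed
  then have "inj_on m {..<n}"
    by (intro linorder_inj_onI) fastforce+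
  then have "card (m ` {..<n}) = n"
    by (simp add: card_image)
  moreover have "m ` {..<n} \<subseteq> modes f" using m by auto
  ultimately show ?thesis
    unfolding num_modes_def using card_mono[of "modes f" "m ` {..<n}"] by simp
qed

section \<open>Finite mixtures from Riemann sums\<close>

text \<open>Bridges Riemann sums and \<open>gaussian_mixture\<close>, which demands strictly
  positive weights indexed by \<open>{1..N}\<close>: indices of weight zero are dropped and the rest
  are renumbered.\<close>

lemma gaussian_mixture_normalized:
  assumes "finite S" and nonneg: "\<And>i. i \<in> S \<Longrightarrow> 0 \<le> w i" and pos: "0 < sum w S"
    and a: "\<And>i. i \<in> S \<Longrightarrow> a i \<in> {-A..A}"
  shows "gaussian_mixture A (\<lambda>t. (\<Sum>i\<in>S. w i * std_normal_density (t - a i)) / sum w S)"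
proof -
  define S' where "S' = {i\<in>S. w i \<noteq> 0}"
  have fin: "finite S'" using assms by (simp add: S'_def)
  have sum_S': "(\<Sum>i\<in>S. w i * g i) = (\<Sum>i\<in>S'. w i * g i)" for g :: "_ \<Rightarrow> real"
    by (rule sum.mono_neutral_right) (use assms in \<open>auto simp: S'_def\<close>)
  have W: "sum w S = sum w S'" using sum_S'[of "\<lambda>_. 1"] by simp
  obtain h where h: "bij_betw h {1..card S'} S'"
    using fin ex_bij_betw_nat_finite_1 by blast
  have mem: "h k \<in> S'" if "k \<in> {1..card S'}" for k
    using h that bij_betwE by blast
  have reindex: "(\<Sum>k=1..card S'. g (h k)) = sum g S'" for g :: "_ \<Rightarrow> real"
    using sum.reindex_bij_betw[OF h] .
  show ?thesis
    unfolding gaussian_mixture_def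
  proof (intro exI conjI ballI)
    have "S' \<noteq> {}" using pos W by auto
    then show "1 \<le> card S'" using fin by (simp add: Suc_leI card_gt_0_iff)
    show "0 < w (h k) / sum w S" if "k \<in> {1..card S'}" for k
      using mem[OF that] nonneg[of "h k"] pos by (auto simp: S'_def less_le)
    show "(\<Sum>k = 1..card S'. w (h k) / sum w S) = 1"
      using reindex[of "\<lambda>i. w i / sum w S"] pos W by (simp flip: sum_divide_distrib)
    show "a (h k) \<in> {-A..A}" if "k \<in> {1..card S'}" for k
      using mem[OF that] a by (auto simp: S'_def)
    show "(\<lambda>t. (\<Sum>i\<in>S. w i * std_normal_density (t - a i)) / sum w S) =
      (\<lambda>t. \<Sum>k = 1..card S'. w (h k) / sum w S * std_normal_density (t - a (h k)))"
    proof
      fix t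
      show "(\<Sum>i\<in>S. w i * std_normal_density (t - a i)) / sum w S =
        (\<Sum>k = 1..card S'. w (h k) / sum w S * std_normal_density (t - a (h k)))"
        using reindex[of "\<lambda>i. w i / sum w S * std_normal_density (t - a i)"]
        by (simp add: sum_S' sum_divide_distrib)
    qed
  qed
qed

lemma continuous_on_std_normal_density [continuous_intros]:
  assumes "continuous_on S g"
  shows "continuous_on S (\<lambda>x. std_normal_density (g x))"
  unfolding std_normal_density_def using assms by (intro continuous_intros) auto

lemma gaussian_mixture_continuous:
  assumes "gaussian_mixture A f"
  shows "continuous_on UNIV f"
  using assms unfolding gaussian_mixture_def
  by (auto intro!: continuous_intros)

text \<open>A finite intersection of gauges is a gauge, so a single tagged division serves every
  \<open>t\<close>. The tags will become the means of a mixture and therefore must not depend on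
  \<open>t\<close>.\<close>

lemma simultaneous_riemann_sums:
  fixes g :: "'b \<Rightarrow> real \<Rightarrow> real"
  assumes "finite T" "\<And>t. t \<in> T \<Longrightarrow> (g t has_integral I t) {a..b}" "0 < e"
  obtains p where "p tagged_division_of {a..b}"
    "\<And>t. t \<in> T \<Longrightarrow> \<bar>(\<Sum>(x, k)\<in>p. measure lborel k * g t x) - I t\<bar> < e"
proof -
  have "\<exists>\<gamma>. gauge \<gamma> \<and> (\<forall>p. p tagged_division_of {a..b} \<and> \<gamma> fine p \<longrightarrow>
      \<bar>(\<Sum>(x, k)\<in>p. measure lborel k * g t x) - I t\<bar> < e)" if "t \<in> T" for t
    using assms(2)[OF that] \<open>0 < e\<close> by (simp add: has_integral_real)
  then obtain \<gamma> where gauge: "\<And>t. t \<in> T \<Longrightarrow> gauge (\<gamma> t)"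
    and \<gamma>: "\<And>t p. t \<in> T \<Longrightarrow> p tagged_division_of {a..b} \<Longrightarrow> \<gamma> t fine p \<Longrightarrow>
      \<bar>(\<Sum>(x, k)\<in>p. measure lborel k * g t x) - I t\<bar> < e"
    by metis
  have "gauge (\<lambda>x. \<Inter>{\<gamma> t x | t. t \<in> T})"
    using assms gauge by (intro gauge_Inter)
  then obtain p where "p tagged_division_of {a..b}" "(\<lambda>x. \<Inter>{\<gamma> t x | t. t \<in> T}) fine p"
    by (rule fine_division_exists_real)
  then show thesis
    using that \<gamma> by (simp add: fine_Inter)
qed

text \<open>A Riemann sum in \<open>x\<close> is, as a function of \<open>t\<close>, an unnormalised
  mixture with means at the tags. Finitely many strict inequalities survive a small enough error,
  and division by the total weight keeps them.\<close>

lemma gaussian_mixture_order_approx: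
  fixes w F :: "real \<Rightarrow> real"
  assumes "finite T" and s0: "s0 \<in> T" and t0: "t0 \<in> T" and less: "F s0 < F t0"
    and w: "\<And>x. 0 \<le> w x"
    and F: "\<And>t. t \<in> T \<Longrightarrow> ((\<lambda>x. w x * std_normal_density (t - x)) has_integral F t) {-A..A}"
  obtains f where "gaussian_mixture A f"
    "\<And>s t. s \<in> T \<Longrightarrow> t \<in> T \<Longrightarrow> F s < F t \<Longrightarrow> f s < f t"
proof -
  \<comment> \<open>\<open>e\<close> is half the least positive gap between values of
    \<open>F\<close> on \<open>T\<close>, so errors below \<open>e\<close> at both points cannot
    close any gap. The pair \<open>s0\<close>, \<open>t0\<close> makes \<open>D\<close>
    nonempty.\<close>
  define D where "D = (\<lambda>(s, t). (F t - F s) / 2) ` {(s, t) \<in> T \<times> T. F s < F t}"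
  define e where "e = Min D"
  have "{(s, t) \<in> T \<times> T. F s < F t} \<subseteq> T \<times> T" by auto
  then have "finite {(s, t) \<in> T \<times> T. F s < F t}"
    using \<open>finite T\<close> finite_subset by blast
  then have D: "finite D" "D \<noteq> {}"
    using s0 t0 less by (auto simp: D_def)
  then have "0 < e" by (auto simp: e_def D_def)
  have e: "e \<le> (F t - F s) / 2" if "s \<in> T" "t \<in> T" "F s < F t" for s t
    unfolding e_def by (rule Min_le[OF D(1)]) (use that in \<open>auto simp: D_def\<close>)
  obtain p where p: "p tagged_division_of {-A..A}"
    and approx: "\<And>t. t \<in> T \<Longrightarrow>
      \<bar>(\<Sum>(x, k)\<in>p. measure lborel k * (w x * std_normal_density (t - x))) - F t\<bar> < e"
    using simultaneous_riemann_sums[where g = "\<lambda>t x. w x * std_normal_density (t - x)",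
        OF \<open>finite T\<close> F \<open>0 < e\<close>] by blast
  define v where "v = (\<lambda>(x, k::real set). measure lborel k * w x)"
  define R where "R t = (\<Sum>i\<in>p. v i * std_normal_density (t - fst i))" for t
  have fin: "finite p" using p by blast
  have v: "0 \<le> v i" for i using w by (auto simp: v_def split: prod.splits)
  have R: "\<bar>R t - F t\<bar> < e" if "t \<in> T" for t
    using approx[OF that] by (simp add: R_def v_def case_prod_beta mult.assoc)
  have R_less: "R s < R t" if "s \<in> T" "t \<in> T" "F s < F t" for s t
    using R[OF that(1)] R[OF that(2)] e[OF that] unfolding abs_diff_less_iff by argo
  \<comment> \<open>The total weight is positive: otherwise \<open>R\<close> would vanish
    identically, contradicting \<open>R s0 < R t0\<close>.\<close>
  have "0 \<le> R s0"
    unfolding R_def by (intro sum_nonneg mult_nonneg_nonneg v) auto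
  then have "R t0 \<noteq> 0" using R_less[OF s0 t0 less] by auto
  then have "\<exists>i\<in>p. v i \<noteq> 0"
    unfolding R_def by (metis (no_types, lifting) mult_eq_0_iff sum.neutral)
  then have W: "0 < sum v p"
    using fin v by (metis less_le sum_pos2)
  have "gaussian_mixture A (\<lambda>t. R t / sum v p)"
    unfolding R_def
  proof (rule gaussian_mixture_normalized[OF fin v W])
    show "fst i \<in> {-A..A}" if "i \<in> p" for i
      using tagged_division_ofD(2,3)[OF p, of "fst i" "snd i"] that by auto
  qed
  then show thesis
    by (rule that) (use R_less W in \<open>auto intro: divide_strict_right_mono\<close>)
qed

section \<open>The ripple on the whole line and its truncation\<close>

text \<open>This is the characteristic function of the standard normal law at
  \<open>- \<omega>\<close>, after the substitution \<open>y = t - x\<close>, multiplication by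
  \<open>iexp (\<omega> * t)\<close> and passage to real parts.\<close>

lemma has_integral_cos_std_normal_density:
  "((\<lambda>x. cos (\<omega> * x) * std_normal_density (t - x)) has_integral exp (- \<omega>\<^sup>2 / 2) * cos (\<omega> * t)) UNIV"
proof -
  define f where "f y = std_normal_density y *\<^sub>R iexp ((- \<omega>) * y)" for y
  have int: "integrable lborel f"
    unfolding f_def
    by (rule Bochner_Integration.integrable_bound[OF integrable_normal_density[of 1 0]]) auto
  have "integral\<^sup>L lborel f = char std_normal_distribution (- \<omega>)"
    unfolding char_def f_def by (subst integral_density) auto
  also have "\<dots> = exp (- \<omega>\<^sup>2 / 2)"
    by (simp add: char_std_normal_distribution)
  finally have "has_bochner_integral lborel f (exp (- \<omega>\<^sup>2 / 2))"
    using int by (simp add: has_bochner_integral_iff)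
  then have "has_bochner_integral lborel (\<lambda>x. f (t + (- 1) * x)) (exp (- \<omega>\<^sup>2 / 2))"
    using lborel_has_bochner_integral_real_affine_iff[of "-1" f _ t] by simp
  then have "has_bochner_integral lborel (\<lambda>x. Re (iexp (\<omega> * t) * f (t - x)))
      (Re (iexp (\<omega> * t) * exp (- \<omega>\<^sup>2 / 2)))"
    by (intro has_bochner_integral_Re has_bochner_integral_mult_right) simp_all
  moreover have "Re (iexp (\<omega> * t) * f (t - x)) = cos (\<omega> * x) * std_normal_density (t - x)" for x
  proof -
    have "iexp (\<omega> * t) * iexp ((- \<omega>) * (t - x)) = iexp (\<omega> * x)"
      by (simp add: algebra_simps flip: exp_add)
    then have "iexp (\<omega> * t) * f (t - x) = std_normal_density (t - x) *\<^sub>R iexp (\<omega> * x)"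
      unfolding f_def by (metis mult_scaleR_right)
    then show ?thesis by (simp add: Re_exp)
  qed
  moreover have "Re (iexp (\<omega> * t) * exp (- \<omega>\<^sup>2 / 2)) = exp (- \<omega>\<^sup>2 / 2) * cos (\<omega> * t)"
    by (simp add: Re_exp)
  ultimately show ?thesis
    using has_integral_integral_lborel by (metis (no_types, lifting) has_bochner_integral_iff ext)
qed

text \<open>The integrand is nonnegative, so truncation only lowers the integral. The loss is a
  Gaussian tail, since points outside \<open>[-A, A]\<close> are at distance at least
  \<open>A / 2\<close> from \<open>t\<close>.\<close>

lemma truncated_ripple_bounds:
  fixes A \<omega> t :: real
  defines "g \<equiv> \<lambda>x. (1 - cos (\<omega> * x)) * std_normal_density (t - x)"
  assumes t: "\<bar>t\<bar> \<le> A / 2"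
  shows "integral {-A..A} g \<le> 1 - exp (- \<omega>\<^sup>2 / 2) * cos (\<omega> * t)"
    and "1 - exp (- \<omega>\<^sup>2 / 2) * cos (\<omega> * t) - 2 * sqrt 2 * exp (- A\<^sup>2 / 16) \<le> integral {-A..A} g"
proof -
  let ?G = "1 - exp (- \<omega>\<^sup>2 / 2) * cos (\<omega> * t)"
  have "((\<lambda>x. std_normal_density (t - x)) has_integral 1) UNIV"
    using has_integral_cos_std_normal_density[of 0 t] by simp
  from has_integral_diff[OF this has_integral_cos_std_normal_density[of \<omega> t]]
  have G: "(g has_integral ?G) UNIV"
    by (simp add: g_def algebra_simps)
  have "g integrable_on {-A..A}"
    unfolding g_def by (intro integrable_continuous_real continuous_intros)
  then have I: "(g has_integral integral {-A..A} g) {-A..A}" by blast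
  have nonneg: "0 \<le> g x" for x by (simp add: g_def)
  show "integral {-A..A} g \<le> ?G"
    by (rule has_integral_subset_le[OF _ I G]) (use nonneg in auto)
  have "((\<lambda>x. if x \<in> {-A..A} then g x else 0) has_integral integral {-A..A} g) UNIV"
    using I by (simp only: has_integral_restrict_UNIV)
  from has_integral_diff[OF G this]
  have tail: "((\<lambda>x. g x - (if x \<in> {-A..A} then g x else 0)) has_integral ?G - integral {-A..A} g) UNIV" .
  \<comment> \<open>Half of the exponent pays for the factor \<open>exp (- A\<^sup>2 / 16)\<close>;
    the other half is a Gaussian of variance 2 with total mass 1. The factor \<open>sqrt 2\<close>
    is the ratio of the normalising constants, and 2 bounds \<open>1 - cos\<close>.\<close>
  have "(normal_density t (sqrt 2) has_integral 1) UNIV"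
    using has_integral_integral_lborel[OF integrable_normal_density[of "sqrt 2" t]] by simp
  from has_integral_mult_right[OF this, of "2 * sqrt 2 * exp (- A\<^sup>2 / 16)"]
  have bound: "((\<lambda>x. 2 * sqrt 2 * exp (- A\<^sup>2 / 16) * normal_density t (sqrt 2) x)
      has_integral 2 * sqrt 2 * exp (- A\<^sup>2 / 16)) UNIV" by simp
  have "?G - integral {-A..A} g \<le> 2 * sqrt 2 * exp (- A\<^sup>2 / 16)"
  proof (rule has_integral_le[OF tail bound])
    fix x :: real
    show "g x - (if x \<in> {-A..A} then g x else 0)
        \<le> 2 * sqrt 2 * exp (- A\<^sup>2 / 16) * normal_density t (sqrt 2) x"
    proof (cases "x \<in> {-A..A}")
      case False
      then have "\<bar>A / 2\<bar> \<le> \<bar>t - x\<bar>" using t by auto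
      then have "(A / 2)\<^sup>2 \<le> (t - x)\<^sup>2" by (rule power2_mono)
      then have "exp (- (t - x)\<^sup>2 / 2) \<le> exp (- A\<^sup>2 / 16 + - (t - x)\<^sup>2 / 4)"
        by (simp add: power_divide)
      then have "std_normal_density (t - x)
          \<le> exp (- A\<^sup>2 / 16) * exp (- (t - x)\<^sup>2 / 4) / sqrt (2 * pi)"
        unfolding std_normal_density_def exp_add[symmetric] by (simp add: divide_right_mono)
      also have "\<dots> = sqrt 2 * exp (- A\<^sup>2 / 16) * normal_density t (sqrt 2) x"
        by (simp add: normal_density_def real_sqrt_mult power2_commute field_simps)
      finally have "std_normal_density (t - x) \<le> sqrt 2 * exp (- A\<^sup>2 / 16) * normal_density t (sqrt 2) x" .
      moreover have "g x \<le> 2 * std_normal_density (t - x)"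
        unfolding g_def using cos_ge_minus_one[of "\<omega> * x"]
        by (intro mult_right_mono) auto
      ultimately show ?thesis using False by simp
    qed auto
  qed
  then show "?G - 2 * sqrt 2 * exp (- A\<^sup>2 / 16) \<le> integral {-A..A} g" by simp
qed

section \<open>Lower bounds for the maximal number of modes\<close>

lemma max_modes_upper:
  assumes "gaussian_mixture A f" "enat n \<le> num_modes f"
  shows "enat n \<le> max_modes A"
  unfolding max_modes_def using assms by (auto intro: SUP_upper2)

text \<open>A single Gaussian centred at 0 settles the small values of \<open>A\<close>, where the
  ripple construction is not applied.\<close>

lemma max_modes_ge_1:
  assumes "0 < A"
  shows "enat 1 \<le> max_modes A"
proof (rule max_modes_upper)
  have "gaussian_mixture A (\<lambda>t. (\<Sum>i\<in>{0::nat}. 1 * std_normal_density (t - 0)) / (\<Sum>i\<in>{0::nat}. 1))"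
    using assms by (intro gaussian_mixture_normalized) auto
  then show "gaussian_mixture A std_normal_density" by simp
  have "0 \<in> modes std_normal_density"
    by (simp add: modes_def std_normal_density_def divide_right_mono)
  then show "enat 1 \<le> num_modes std_normal_density"
    by (auto simp: num_modes_def Suc_le_eq card_gt_0_iff one_enat_def)
qed

lemma max_modes_ge:
  assumes A: "0 < A" "128 \<le> A\<^sup>2" and n: "64 * real n \<le> A\<^sup>2"
  shows "enat n \<le> max_modes A"
proof (cases "n = 0")
  case False
  \<comment> \<open>With frequency \<open>A / 4\<close>, these are the successive extrema of the
    cosine, starting at 0. Since \<open>pi < 4\<close>, the condition
    \<open>64 * real n \<le> A\<^sup>2\<close> keeps the first \<open>2 * n + 1\<close> of them
    within \<open>[0, A / 2]\<close>.\<close>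
  define u where "u i = 4 * pi * real i / A" for i :: nat
  define F where "F t = integral {-A..A} (\<lambda>x. (1 - cos (A / 4 * x)) * std_normal_density (t - x))" for t
  define d where "d = exp (- A\<^sup>2 / 32)"
  have d: "exp (- (A / 4)\<^sup>2 / 2) = d"
    by (simp add: d_def power_divide)
  have cos_u: "cos (A / 4 * u i) = (- 1) ^ i" for i
    using A cos_npi[of i] by (simp add: u_def mult.commute)
  have u_le: "\<bar>u i\<bar> \<le> A / 2" if "i \<le> 2 * n" for i
  proof -
    have "pi * real i \<le> 4 * (2 * real n)"
      using that pi_less_4 by (intro mult_mono) auto
    then have "4 * pi * real i \<le> A / 2 * A"
      using n by (simp add: power2_eq_square)
    then show ?thesis
      using A by (simp add: u_def divide_le_eq)
  qed
  \<comment> \<open>Aim: the truncation error stays below \<open>2 * d\<close>, the full height of a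
    ripple from trough to crest.\<close>
  have "sqrt 2 < 1 + A\<^sup>2 / 32"
    using A sqrt2_less_2 by linarith
  also have "\<dots> \<le> exp (A\<^sup>2 / 32)" by (rule exp_ge_add_one_self)
  finally have "sqrt 2 * (d * d) < exp (A\<^sup>2 / 32) * (d * d)"
    by (simp add: d_def)
  moreover have "d * d = exp (- A\<^sup>2 / 16)" "exp (A\<^sup>2 / 32) * (d * d) = d"
    by (simp_all add: d_def flip: exp_add)
  ultimately have small: "2 * sqrt 2 * exp (- A\<^sup>2 / 16) < 2 * d"
    by (metis mult.assoc mult_strict_left_mono zero_less_numeral)
  \<comment> \<open>The level \<open>1 - d\<close> separates the two parities: truncation cannot
    raise a trough above it, and a crest, \<open>1 + d\<close> before truncation, loses less than
    \<open>2 * d\<close>.\<close>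
  have F_even: "F (u i) \<le> 1 - d" if "i \<le> 2 * n" "even i" for i
    using truncated_ripple_bounds(1)[OF u_le[OF that(1)], of "A / 4"] that(2)
    by (simp only: F_def d cos_u) simp
  have F_odd: "1 - d < F (u i)" if "i \<le> 2 * n" "odd i" for i
    using truncated_ripple_bounds(2)[OF u_le[OF that(1)], of "A / 4"] that(2) small
    by (simp only: F_def d cos_u) simp
  have F: "F (u i) < F (u j)" if "i \<le> 2 * n" "j \<le> 2 * n" "even i" "odd j" for i j
    using F_even[of i] F_odd[of j] that by linarith
  obtain f where f: "gaussian_mixture A f"
    and f_less: "\<And>s t. s \<in> u ` {..2 * n} \<Longrightarrow> t \<in> u ` {..2 * n} \<Longrightarrow> F s < F t \<Longrightarrow> f s < f t"
  proof (rule gaussian_mixture_order_approx[of "u ` {..2 * n}" "u 0" "u 1" F "\<lambda>x. 1 - cos (A / 4 * x)" A])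
    show "((\<lambda>x. (1 - cos (A / 4 * x)) * std_normal_density (t - x)) has_integral F t) {-A..A}" for t
      unfolding F_def
      by (intro integrable_integral integrable_continuous_real continuous_intros)
    show "F (u 0) < F (u 1)" using F[of 0 1] False by simp
  qed (use False in auto)
  have "enat n \<le> num_modes f"
  proof (rule num_modes_ge[of f u])
    show "continuous_on UNIV f" by (rule gaussian_mixture_continuous[OF f])
    show "strict_mono u"
      using A by (auto simp: u_def strict_mono_def intro!: divide_strict_right_mono)
    show "f (u (2 * j)) < f (u (2 * j + 1))" "f (u (2 * j + 2)) < f (u (2 * j + 1))" if "j < n" for j
      using that by (auto intro!: f_less F)
  qed
  then show ?thesis by (rule max_modes_upper[OF f])
qed (simp flip: zero_enat_def)

theorem proposition1:
  shows "\<exists>c0::real. c0 > 0 \<and>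
    (\<forall>A::real. A > 0 \<longrightarrow> ereal_of_enat (max_modes A) \<ge> ereal (c0 * A\<^sup>2))"
proof (intro exI[of _ "1 / 128"] conjI allI impI)
  fix A :: real
  assume A: "A > 0"
  \<comment> \<open>For \<open>128 \<le> A\<^sup>2\<close>, rounding \<open>A\<^sup>2 / 64\<close>
    down loses less than 1, which is at most \<open>A\<^sup>2 / 128\<close>. For smaller
    \<open>A\<close> the bound is below 1 and one mode suffices.\<close>
  have "\<exists>n. enat n \<le> max_modes A \<and> 1 / 128 * A\<^sup>2 \<le> real n"
  proof (cases "128 \<le> A\<^sup>2")
    case True
    define n where "n = nat \<lfloor>A\<^sup>2 / 64\<rfloor>"
    have "real n = of_int \<lfloor>A\<^sup>2 / 64\<rfloor>" by (simp add: n_def)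
    then have "real n \<le> A\<^sup>2 / 64" "A\<^sup>2 / 64 < real n + 1"
      using floor_correct[of "A\<^sup>2 / 64"] by simp_all
    then have "64 * real n \<le> A\<^sup>2" "1 / 128 * A\<^sup>2 \<le> real n"
      using True by linarith+
    then show ?thesis
      using max_modes_ge[OF A True] by blast
  next
    case False
    then show ?thesis
      using max_modes_ge_1[OF A] by (intro exI[of _ 1]) simp
  qed
  then obtain n where n: "enat n \<le> max_modes A" "1 / 128 * A\<^sup>2 \<le> real n"
    by blast
  have "ereal (1 / 128 * A\<^sup>2) \<le> ereal_of_enat (enat n)"
    using n(2) by simp
  also have "\<dots> \<le> ereal_of_enat (max_modes A)"
    using n(1) by (simp only: ereal_of_enat_le_iff)
  finally show "ereal (1 / 128 * A\<^sup>2) \<le> ereal_of_enat (max_modes A)" .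
qed simp

end
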